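(* Let $\mathfrak{g}=\mathbb{R}e_0\ltimes_M\mathfrak{u}$ be an almost abelian Lie algebra of dimension $2n+1$. If $\mathfrak{g}$ admits a coKähler structure $(\xi,J,\alpha,\langle\cdot,\cdot\rangle)$, then either $M\in\mathfrak{u}(n)$ (with respect to a suitable Hermitian structure on the vector space $\mathfrak{u}$), or there exists an adapted orthonormal basis $\{u_0,Jh_0,x_1,Jx_1,\dots,x_{n-1},Jx_{n-1}\}$ of $\mathfrak{u}$ (as described in the context) with respect to which $$M=\left(\begin{array}{c|c|c}0&0&0\\ \hline 0&m&0\\ \hline 0&0&\tilde M\end{array}\right),\qquad m\in\mathbb{R},\quad \tilde M\in\mathfrak{u}(n-1),$$ where the diagonal blocks have sizes $1$, $1$ and $2n-2$. (The two alternatives are not claimed to be mutually exclusive.)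
   Context: All Lie algebras are real and finite-dimensional. Almost abelian: $\mathfrak{g}=\mathbb{R}e_0\ltimes_M\mathfrak{u}$ means that $\mathfrak{u}$ is an abelian ideal of codimension one, $e_0\notin\mathfrak{u}$, and $M=\mathrm{ad}_{e_0}|_{\mathfrak{u}}$. CoKähler structure: a quadruple consisting of a non-zero $\xi\in\mathfrak{g}$, an endomorphism $J$ of $\mathfrak{g}$, $\alpha\in\mathfrak{g}^*$ and an inner product $\langle\cdot,\cdot\rangle$ on $\mathfrak{g}$ with $\alpha(\xi)=1$, $J^2=-\mathrm{Id}+\alpha\otimes\xi$, $\langle JX,JY\rangle=\langle X,Y\rangle-\alpha(X)\alpha(Y)$, $d\alpha=0$, $N_J=0$, $d\omega=0$, where $\omega(X,Y)=\langle JX,Y\rangle$, $d$ is the Chevalley–Eilenberg differential and $N_J(X,Y)=[JX,JY]-J[JX,Y]-J[X,JY]+J^2[X,Y]$. Put $\mathfrak{h}=\ker\alpha=\xi^\perp$. It is a $J$-invariant ideal and, with the restrictions of $J$ and $\langle\cdot,\cdot\rangle$, a Kähler Lie algebra. Moreover $\mathfrak{g}=\mathbb{R}\xi\ltimes_D\mathfrak{h}$ with $D=\mathrm{ad}_\xi|_{\mathfrak{h}}$ a skew-symmetric derivation commuting with $J|_{\mathfrak{h}}$. Unitary matrices: $\mathfrak{u}(k)$ denotes the real $2k\times 2k$ matrices (or endomorphisms of a $2k$-dimensional real vector space with an inner product and an orthogonal complex structure) that are skew-symmetric and commute with the complex structure. "$M\in\mathfrak{u}(n)$" means that there exist an inner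 product and an orthogonal complex structure on $\mathfrak{u}$ for which $M$ is skew-symmetric and commutes with the complex structure. "$\tilde M\in\mathfrak{u}(n-1)$" is with respect to the basis $\{x_1,Jx_1,\dots,x_{n-1},Jx_{n-1}\}$, with its orthonormal inner product and the complex structure $J$. Adapted basis (defined when $\mathfrak{h}\neq\mathfrak{u}$): let $W=\mathfrak{h}\cap\mathfrak{u}$, which has dimension $2n-1$. Let $h_0\in\mathfrak{h}$ and $u_0\in\mathfrak{u}$ be unit vectors orthogonal to $W$. Then $Jh_0\in W$, and $\{Jh_0,x_1,Jx_1,\dots,x_{n-1},Jx_{n-1}\}$ is an orthonormal basis of $W$, so that adding $u_0$ gives an orthonormal basis of $\mathfrak{u}$. *)

theory Defs
  imports Complex_Main "Jordan_Normal_Form.Matrix"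
begin

section \<open>Real finite-dimensional Lie algebras\<close>

definition lie_algebra :: "('a::real_vector \<Rightarrow> 'a \<Rightarrow> 'a) \<Rightarrow> bool" where
  "lie_algebra br \<longleftrightarrow>
     (\<exists>B :: 'a set. finite B \<and> span B = UNIV) \<and>
     (\<forall>x. linear (br x)) \<and> (\<forall>y. linear (\<lambda>x. br x y)) \<and>
     (\<forall>x. br x x = 0) \<and>
     (\<forall>x y z. br x (br y z) + br y (br z x) + br z (br x y) = 0)"

definition lie_ideal :: "('a::real_vector \<Rightarrow> 'a \<Rightarrow> 'a) \<Rightarrow> 'a set \<Rightarrow> bool" where
  "lie_ideal br I \<longleftrightarrow> subspace I \<and> (\<forall>x. \<forall>y\<in>I. br x y \<in> I)"

text \<open>The decomposition \<open>\<real>e\<^sub>0 \<ltimes>\<^sub>M \<uu>\<close> of the whole type. Only the values of \<open>M\<close> on \<open>\<uu>\<close> matter.\<close>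

definition almost_abelian ::
    "('a::real_vector \<Rightarrow> 'a \<Rightarrow> 'a) \<Rightarrow> 'a \<Rightarrow> ('a \<Rightarrow> 'a) \<Rightarrow> 'a set \<Rightarrow> bool" where
  "almost_abelian br e0 M \<uu> \<longleftrightarrow>
     lie_algebra br \<and> lie_ideal br \<uu> \<and>
     (\<forall>x\<in>\<uu>. \<forall>y\<in>\<uu>. br x y = 0) \<and>
     dim (UNIV :: 'a set) = dim \<uu> + 1 \<and> e0 \<notin> \<uu> \<and>
     (\<forall>x\<in>\<uu>. M x = br e0 x)"


section \<open>Inner products, complex structures and unitary endomorphisms\<close>

definition inner_product_on :: "'a::real_vector set \<Rightarrow> ('a \<Rightarrow> 'a \<Rightarrow> real) \<Rightarrow> bool" where
  "inner_product_on V ip \<longleftrightarrow>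
     (\<forall>x\<in>V. \<forall>y\<in>V. \<forall>z\<in>V. ip (x + y) z = ip x z + ip y z) \<and>
     (\<forall>c. \<forall>x\<in>V. \<forall>y\<in>V. ip (c *\<^sub>R x) y = c * ip x y) \<and>
     (\<forall>x\<in>V. \<forall>y\<in>V. ip x y = ip y x) \<and>
     (\<forall>x\<in>V. x \<noteq> 0 \<longrightarrow> ip x x > 0)"

definition endomorphism_on :: "'a::real_vector set \<Rightarrow> ('a \<Rightarrow> 'a) \<Rightarrow> bool" where
  "endomorphism_on V f \<longleftrightarrow>
     (\<forall>x\<in>V. f x \<in> V) \<and>
     (\<forall>x\<in>V. \<forall>y\<in>V. f (x + y) = f x + f y) \<and>
     (\<forall>c. \<forall>x\<in>V. f (c *\<^sub>R x) = c *\<^sub>R f x)"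

definition hermitian_structure_on ::
    "'a::real_vector set \<Rightarrow> ('a \<Rightarrow> 'a \<Rightarrow> real) \<Rightarrow> ('a \<Rightarrow> 'a) \<Rightarrow> bool" where
  "hermitian_structure_on V ip K \<longleftrightarrow>
     inner_product_on V ip \<and> endomorphism_on V K \<and>
     (\<forall>x\<in>V. K (K x) = - x) \<and>
     (\<forall>x\<in>V. \<forall>y\<in>V. ip (K x) (K y) = ip x y)"

definition unitary_endomorphism_on ::
    "'a::real_vector set \<Rightarrow> ('a \<Rightarrow> 'a \<Rightarrow> real) \<Rightarrow> ('a \<Rightarrow> 'a) \<Rightarrow> ('a \<Rightarrow> 'a) \<Rightarrow> bool" where
  "unitary_endomorphism_on V ip K f \<longleftrightarrow>
     endomorphism_on V f \<and>
     (\<forall>x\<in>V. \<forall>y\<in>V. ip (f x) y = - ip x (f y)) \<and>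
     (\<forall>x\<in>V. f (K x) = K (f x))"

text \<open>Matrix of the complex structure \<open>J\<close> in the ordered basis \<open>x\<^sub>1, Jx\<^sub>1, \<dots>, x\<^sub>k, Jx\<^sub>k\<close>:
  block diagonal with \<open>k\<close> blocks having rows \<open>(0, -1)\<close> and \<open>(1, 0)\<close>.\<close>

definition complex_structure_mat :: "nat \<Rightarrow> real mat" where
  "complex_structure_mat k = mat (2 * k) (2 * k)
     (\<lambda>(i, j). if even j \<and> i = j + 1 then 1 else if odd j \<and> j = i + 1 then - 1 else 0)"

definition unitary_mats :: "nat \<Rightarrow> real mat set" where
  "unitary_mats k = {A \<in> carrier_mat (2 * k) (2 * k).
     transpose_mat A = - A \<and>
     A * complex_structure_mat k = complex_structure_mat k * A}"


section \<open>CoKaehler structures\<close>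

text \<open>The Chevalley--Eilenberg differential (trivial coefficients) on 1-forms and on 2-forms.\<close>

definition ce_d1 :: "('a \<Rightarrow> 'a \<Rightarrow> 'a) \<Rightarrow> ('a \<Rightarrow> real) \<Rightarrow> 'a \<Rightarrow> 'a \<Rightarrow> real" where
  "ce_d1 br \<alpha> x y = - \<alpha> (br x y)"

definition ce_d2 :: "('a \<Rightarrow> 'a \<Rightarrow> 'a) \<Rightarrow> ('a \<Rightarrow> 'a \<Rightarrow> real) \<Rightarrow> 'a \<Rightarrow> 'a \<Rightarrow> 'a \<Rightarrow> real" where
  "ce_d2 br \<omega> x y z = - \<omega> (br x y) z + \<omega> (br x z) y - \<omega> (br y z) x"

definition nijenhuis ::
    "('a::real_vector \<Rightarrow> 'a \<Rightarrow> 'a) \<Rightarrow> ('a \<Rightarrow> 'a) \<Rightarrow> 'a \<Rightarrow> 'a \<Rightarrow> 'a" where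
  "nijenhuis br J x y = br (J x) (J y) - J (br (J x) y) - J (br x (J y)) + J (J (br x y))"

definition coKaehler ::
    "('a::real_vector \<Rightarrow> 'a \<Rightarrow> 'a) \<Rightarrow> 'a \<Rightarrow> ('a \<Rightarrow> 'a) \<Rightarrow> ('a \<Rightarrow> real) \<Rightarrow> ('a \<Rightarrow> 'a \<Rightarrow> real) \<Rightarrow> bool"
  where
  "coKaehler br \<xi> J \<alpha> ip \<longleftrightarrow>
     \<xi> \<noteq> 0 \<and> linear J \<and> linear \<alpha> \<and> inner_product_on UNIV ip \<and>
     \<alpha> \<xi> = 1 \<and>
     (\<forall>x. J (J x) = - x + \<alpha> x *\<^sub>R \<xi>) \<and>
     (\<forall>x y. ip (J x) (J y) = ip x y - \<alpha> x * \<alpha> y) \<and>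
     (\<forall>x y. ce_d1 br \<alpha> x y = 0) \<and>
     (\<forall>x y. nijenhuis br J x y = 0) \<and>
     (\<forall>x y z. ce_d2 br (\<lambda>x y. ip (J x) y) x y z = 0)"


section \<open>Adapted bases and matrices of endomorphisms\<close>

definition orthonormal_basis ::
    "('a::real_vector \<Rightarrow> 'a \<Rightarrow> real) \<Rightarrow> 'a set \<Rightarrow> 'a list \<Rightarrow> bool" where
  "orthonormal_basis ip V bs \<longleftrightarrow>
     span (set bs) = V \<and>
     (\<forall>i<length bs. \<forall>j<length bs. ip (bs ! i) (bs ! j) = (if i = j then 1 else 0))"

definition J_pairs :: "('a \<Rightarrow> 'a) \<Rightarrow> 'a list \<Rightarrow> 'a list" where
  "J_pairs J xs = concat (map (\<lambda>x. [x, J x]) xs)"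

text \<open>\<open>\<hh>\<close> is the kernel of \<open>\<alpha>\<close>, \<open>W = \<hh> \<inter> \<uu>\<close>, and the adapted basis itself is
  \<open>u0 # J h0 # J_pairs J xs\<close>.\<close>

definition adapted_basis ::
    "('a::real_vector \<Rightarrow> 'a) \<Rightarrow> ('a \<Rightarrow> real) \<Rightarrow> ('a \<Rightarrow> 'a \<Rightarrow> real) \<Rightarrow> 'a set \<Rightarrow>
     'a \<Rightarrow> 'a \<Rightarrow> 'a list \<Rightarrow> bool" where
  "adapted_basis J \<alpha> ip \<uu> h0 u0 xs \<longleftrightarrow>
     (let \<hh> = {x. \<alpha> x = 0}; W = \<hh> \<inter> \<uu> in
       \<hh> \<noteq> \<uu> \<and>
       h0 \<in> \<hh> \<and> ip h0 h0 = 1 \<and> (\<forall>w\<in>W. ip h0 w = 0) \<and>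
       u0 \<in> \<uu> \<and> ip u0 u0 = 1 \<and> (\<forall>w\<in>W. ip u0 w = 0) \<and>
       orthonormal_basis ip W (J h0 # J_pairs J xs) \<and>
       orthonormal_basis ip \<uu> (u0 # J h0 # J_pairs J xs))"

text \<open>\<open>A\<close> is the matrix of \<open>f\<close> in the ordered basis \<open>bs\<close>: column \<open>j\<close> holds the
  coordinates of the image of the \<open>j\<close>-th basis vector.\<close>

definition has_matrix :: "'a::real_vector list \<Rightarrow> ('a \<Rightarrow> 'a) \<Rightarrow> real mat \<Rightarrow> bool" where
  "has_matrix bs f A \<longleftrightarrow>
     A \<in> carrier_mat (length bs) (length bs) \<and>
     (\<forall>j<length bs. f (bs ! j) = (\<Sum>i<length bs. A $$ (i, j) *\<^sub>R (bs ! i)))"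

end

theory Submission
  imports Defs
begin

section \<open>Inner products on finite-dimensional spaces\<close>

text \<open>Everything reduces to identifying \<open>M\<close> on \<uu> with a multiple of one
  adjoint map. Write \<hh> for the kernel of \<alpha>. If \<hh> = \<uu>, then \<open>e0\<close>
  differs from a multiple of \<xi> by an element of the abelian ideal \<uu>, so \<open>M\<close> is
  a multiple of ad \<xi>. The equations N_J = 0 and d\<omega> = 0 with \<xi> as one argument say
  that ad \<xi> commutes with \<open>J\<close> and is skew (\<open>br_xi_J\<close>,
  \<open>br_xi_skew\<close>), and \<open>J\<close> with the given inner product is the required
  Hermitian structure on \<uu>.

  If \<hh> and \<uu> differ, neither contains the other, so unit normals \<open>h0\<close> and
  \<open>u0\<close> of the intersection exist, and on \<uu> the map \<open>M\<close> is a multiple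
  of ad \<open>h0\<close>. Since \<open>J h0\<close> is orthogonal to \<open>h0\<close>, it lies in
  \<uu> and commutes with \<uu>. This kills enough terms of N_J and d\<omega> for ad
  \<open>h0\<close> to be unitary on \<open>W'\<close>, the orthogonal complement of
  \<open>h0\<close> and \<open>J h0\<close> in \<hh> (\<open>br_h0_J_W'\<close>,
  \<open>br_h0_W'\<close>, \<open>br_h0_skew_W'\<close>), and to have \<open>J h0\<close> as an
  eigenvector (\<open>br_h0_J_h0\<close>). Finally \<open>br_h0_u0\<close> shows that
  \<open>h0\<close> and \<open>u0\<close> commute, which gives the zero block.\<close>

lemma finite_spanning_subset:
  fixes V B :: "'a::real_vector set"
  assumes "finite B" "span B = UNIV" "subspace V"
  obtains S where "finite S" "span S = V"
proof -
  obtain S :: "'a set" where S: "S \<subseteq> V" "independent S" "V \<subseteq> span S"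
    using real_vector.basis_exists by metis
  have "finite S"
    using real_vector.independent_span_bound[OF assms(1) S(2)] assms(2) by auto
  moreover have "span S = V"
    using S assms(3) by (simp add: real_vector.span_minimal subset_antisym)
  ultimately show thesis using that by blast
qed

text \<open>Finite dimension is given only by a finite spanning set, so a basis is extracted from it
  to instantiate the finite-dimensional theory.\<close>

lemma dim_less_if_subspace_psubset:
  fixes V T B :: "'a::real_vector set"
  assumes "finite B" "span B = UNIV" "subspace V" "subspace T" "V \<subset> T"
  shows "dim V < dim T"
proof -
  obtain B' :: "'a set" where B': "B' \<subseteq> B" "independent B'" "B \<subseteq> span B'"
    using real_vector.maximal_independent_subset by metis
  have fin: "finite B'" using B' assms(1) finite_subset by blast
  have sp: "span B' = UNIV"
    using B'(3) assms(2) by (metis real_vector.span_minimal real_vector.subspace_span top.extremum_uniqueI)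
  interpret fd: finite_dimensional_vector_space "scaleR :: real \<Rightarrow> 'a \<Rightarrow> 'a" B'
    by unfold_locales (use fin sp B'(2) in \<open>auto simp: dependent_raw_def span_raw_def\<close>)
  show ?thesis
    using fd.dim_psubset[folded dim_raw_def span_raw_def, of V T] assms(3-5)
    by (simp add: real_vector.span_eq_iff[THEN iffD2])
qed

locale inner_product_form =
  fixes ip :: "'a::real_vector \<Rightarrow> 'a \<Rightarrow> real"
  assumes inner_product: "inner_product_on UNIV ip"
begin

lemma ip_add_left: "ip (x + y) z = ip x z + ip y z"
  and ip_scale_left: "ip (c *\<^sub>R x) z = c * ip x z"
  and ip_sym: "ip x y = ip y x"
  and ip_pos: "x \<noteq> 0 \<Longrightarrow> ip x x > 0"
  using inner_product by (auto simp: inner_product_on_def)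

lemma ip_add_right: "ip z (x + y) = ip z x + ip z y"
  by (metis ip_add_left ip_sym)

lemma ip_scale_right: "ip z (c *\<^sub>R x) = c * ip z x"
  by (metis ip_scale_left ip_sym)

lemma ip_zero_left [simp]: "ip 0 x = 0"
  using ip_scale_left[of 0 0 x] by simp

lemma ip_zero_right [simp]: "ip x 0 = 0"
  using ip_scale_right[of x 0 0] by simp

lemma ip_minus_left: "ip (- x) y = - ip x y"
  using ip_scale_left[of "- 1" x y] by simp

lemma ip_minus_right: "ip x (- y) = - ip x y"
  using ip_scale_right[of x "- 1" y] by simp

lemma ip_diff_left: "ip (x - y) z = ip x z - ip y z"
  using ip_add_left[of x "- y" z] by (simp add: ip_minus_left)

lemma ip_diff_right: "ip z (x - y) = ip z x - ip z y"
  using ip_add_right[of z x "- y"] by (simp add: ip_minus_right)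

lemmas ip_simps = ip_add_left ip_add_right ip_scale_left ip_scale_right
  ip_minus_left ip_minus_right ip_diff_left ip_diff_right

lemma ip_self_eq_0 [simp]: "ip x x = 0 \<longleftrightarrow> x = 0"
  by (metis ip_pos ip_zero_left order_less_irrefl)

lemma ip_sum_right: "ip x (\<Sum>i\<in>I. f i) = (\<Sum>i\<in>I. ip x (f i))"
  by (induction I rule: infinite_finite_induct) (auto simp: ip_add_right)

lemma subspace_orthogonal: "subspace {x. ip y x = 0}"
  by (auto simp: subspace_def ip_simps)

lemma unit_normalize:
  assumes "x \<noteq> 0"
  shows "ip ((1 / sqrt (ip x x)) *\<^sub>R x) ((1 / sqrt (ip x x)) *\<^sub>R x) = 1"
  using ip_pos[OF assms] assms by (simp add: ip_simps field_simps)

lemma orthogonal_projection_exists: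
  assumes "finite S"
  shows "\<exists>p\<in>span S. \<forall>w\<in>span S. ip (v - p) w = 0"
  using assms
proof (induction S arbitrary: v rule: finite_induct)
  case empty
  then show ?case by (auto simp: ip_simps)
next
  case (insert s S)
  obtain q where q: "q \<in> span S" "\<forall>w\<in>span S. ip (s - q) w = 0" using insert.IH by blast
  obtain p where p: "p \<in> span S" "\<forall>w\<in>span S. ip (v - p) w = 0" using insert.IH by blast
  define s' where "s' = s - q"
  define c where "c = ip (v - p) s' / ip s' s'"
  have sub: "span S \<subseteq> span (insert s S)" by (simp add: real_vector.span_mono subset_insertI)
  have s'_in: "s' \<in> span (insert s S)"
    unfolding s'_def using q(1) sub by (auto intro: real_vector.span_diff real_vector.span_base)
  have s'_orth: "ip s' w = 0" if "w \<in> span S" for w using q(2) that by (simp add: s'_def)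
  \<comment> \<open>One Gram-Schmidt step. If \<open>s\<close> already lies in
    \<open>span S\<close>, then \<open>s' = 0\<close> and both sides vanish whatever the quotient
    \<open>c\<close> is.\<close>
  have c: "ip (v - p) s' = c * ip s' s'" by (cases "s' = 0") (auto simp: c_def)
  have "ip (v - (p + c *\<^sub>R s')) w = 0" if "w \<in> span (insert s S)" for w
  proof -
    obtain k where k: "w - k *\<^sub>R s \<in> span S" using \<open>w \<in> _\<close> real_vector.span_breakdown_eq by blast
    define z where "z = (w - k *\<^sub>R s) + k *\<^sub>R q"
    have z: "z \<in> span S"
      unfolding z_def using k q(1) by (intro real_vector.span_add real_vector.span_scale)
    have w: "w = z + k *\<^sub>R s'" by (simp add: z_def s'_def algebra_simps)
    have "ip (v - (p + c *\<^sub>R s')) w =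
        ip (v - p) z - c * ip s' z + k * (ip (v - p) s' - c * ip s' s')"
      unfolding w by (simp add: ip_simps algebra_simps)
    then show ?thesis using c s'_orth[OF z] p(2) z by simp
  qed
  moreover have "p + c *\<^sub>R s' \<in> span (insert s S)"
    using p(1) sub s'_in by (auto intro: real_vector.span_add real_vector.span_scale)
  ultimately show ?case by blast
qed

text \<open>Normalise \<open>v\<close> minus its projection to \<open>W\<close>, which is non-zero
  because \<open>v\<close> is outside \<open>W\<close>. This is the source of \<open>h0\<close> and
  \<open>u0\<close>.\<close>

lemma unit_normal_exists:
  assumes "finite (B :: 'a set)" "span B = UNIV" "subspace W" "subspace T" "W \<subseteq> T" "v \<in> T" "v \<notin> W"
  shows "\<exists>h\<in>T. ip h h = 1 \<and> (\<forall>w\<in>W. ip h w = 0)"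
proof -
  obtain S where S: "finite S" "span S = W"
    using finite_spanning_subset assms(1-3) by metis
  obtain p where p: "p \<in> W" "\<forall>w\<in>W. ip (v - p) w = 0"
    using orthogonal_projection_exists[OF S(1), of v] S(2) by blast
  have nz: "v - p \<noteq> 0" using p(1) assms(7) by auto
  have inT: "v - p \<in> T"
    using p(1) assms by (auto intro: real_vector.subspace_diff)
  define h where "h = (1 / sqrt (ip (v - p) (v - p))) *\<^sub>R (v - p)"
  have "h \<in> T" using inT assms(4) by (simp add: h_def real_vector.subspace_scale)
  moreover have "ip h h = 1" unfolding h_def using unit_normalize[OF nz] .
  moreover have "\<forall>w\<in>W. ip h w = 0" using p(2) by (simp add: h_def ip_scale_left)
  ultimately show ?thesis by blast
qed

section \<open>Orthonormal bases as lists, and bases made of pairs \<open>x, J x\<close>\<close>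

lemma orthonormal_basis_Cons:
  assumes "orthonormal_basis ip V bs" "ip y y = 1" "\<forall>v\<in>V. ip y v = 0"
  shows "orthonormal_basis ip (span (insert y V)) (y # bs)"
proof -
  have sp: "span (set bs) = V" using assms(1) by (simp add: orthonormal_basis_def)
  have orth: "ip y (bs ! i) = 0" "ip (bs ! i) y = 0" if "i < length bs" for i
    using assms(3) sp that by (metis ip_sym nth_mem real_vector.span_base)+
  have "span (insert y V) = span (set (y # bs))"
    by (simp add: real_vector.span_insert real_vector.span_span flip: sp)
  moreover have "ip ((y # bs) ! i) ((y # bs) ! j) = (if i = j then 1 else 0)"
    if "i < length (y # bs)" "j < length (y # bs)" for i j
    using that assms(1,2) orth by (cases i; cases j) (auto simp: orthonormal_basis_def)
  ultimately show ?thesis by (simp add: orthonormal_basis_def)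
qed

lemma orthonormal_basis_expand:
  assumes "orthonormal_basis ip V bs" "x \<in> V"
  shows "x = (\<Sum>i<length bs. ip (bs ! i) x *\<^sub>R (bs ! i))"
proof -
  have on: "ip (bs ! i) (bs ! j) = (if i = j then 1 else 0)"
    if "i < length bs" "j < length bs" for i j
    using assms(1) that by (simp add: orthonormal_basis_def)
  define r where "r = x - (\<Sum>i<length bs. ip (bs ! i) x *\<^sub>R (bs ! i))"
  have sp: "span (set bs) = V" using assms(1) by (simp add: orthonormal_basis_def)
  have "r \<in> span (set bs)"
    unfolding r_def using assms(2) sp
    by (intro real_vector.span_diff real_vector.span_sum real_vector.span_scale)
       (auto intro: real_vector.span_base)
  moreover have "ip r (bs ! j) = 0" if "j < length bs" for j
  proof -
    have "ip (bs ! j) (\<Sum>i<length bs. ip (bs ! i) x *\<^sub>R (bs ! i)) =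
        (\<Sum>i<length bs. if i = j then ip (bs ! i) x else 0)"
      unfolding ip_sum_right using that by (intro sum.cong) (auto simp: ip_scale_right on)
    also have "\<dots> = ip (bs ! j) x" using that by simp
    finally show ?thesis by (subst ip_sym) (simp add: r_def ip_diff_right)
  qed
  then have "set bs \<subseteq> {y. ip r y = 0}" by (auto simp: in_set_conv_nth)
  then have "span (set bs) \<subseteq> {y. ip r y = 0}"
    using subspace_orthogonal by (rule real_vector.span_minimal)
  ultimately have "ip r r = 0" by blast
  then show ?thesis by (simp add: r_def)
qed

lemma orthonormal_basis_length:
  assumes "orthonormal_basis ip V bs"
  shows "length bs = dim V"
proof -
  have on: "ip (bs ! i) (bs ! j) = (if i = j then 1 else 0)"
    if "i < length bs" "j < length bs" for i j
    using assms that by (simp add: orthonormal_basis_def)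
  have "distinct bs"
    unfolding distinct_conv_nth using on by (metis zero_neq_one)
  moreover have "independent (set bs)"
  proof (rule real_vector.independent_if_scalars_zero)
    fix f x assume f: "(\<Sum>v\<in>set bs. f v *\<^sub>R v) = 0" and x: "x \<in> set bs"
    have "ip x v = (if v = x then 1 else 0)" if "v \<in> set bs" for v
      using on x that \<open>distinct bs\<close> by (auto simp: in_set_conv_nth nth_eq_iff_index_eq)
    then have "(\<Sum>v\<in>set bs. f v * ip x v) = (\<Sum>v\<in>set bs. if v = x then f v else 0)"
      by (intro sum.cong) auto
    also have "\<dots> = f x" using x by simp
    finally have "f x = ip x (\<Sum>v\<in>set bs. f v *\<^sub>R v)"
      by (simp add: ip_sum_right ip_scale_right)
    then show "f x = 0" using f by simp
  qed simp
  moreover have "span (set bs) = V" using assms by (simp add: orthonormal_basis_def)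
  ultimately show ?thesis
    by (metis distinct_card real_vector.dim_eq_card real_vector.dim_span)
qed

text \<open>Induction on the dimension: \<open>J\<close> is skew on \<open>V\<close>, so a unit
  vector \<open>x\<close> and \<open>J x\<close> are orthonormal, and their common orthogonal
  complement in \<open>V\<close> is again \<open>J\<close>-stable.\<close>

lemma J_pairs_basis_exists:
  assumes fin: "finite (B :: 'a set)" "span B = UNIV"
    and J: "linear J"
    and V: "subspace V" "\<And>x. x \<in> V \<Longrightarrow> J x \<in> V" "\<And>x. x \<in> V \<Longrightarrow> J (J x) = - x"
      "\<And>x y. x \<in> V \<Longrightarrow> y \<in> V \<Longrightarrow> ip (J x) (J y) = ip x y"
  shows "\<exists>xs. orthonormal_basis ip V (J_pairs J xs)"
  using V
proof (induction "dim V" arbitrary: V rule: less_induct)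
  case less
  note V = less.prems
  have skew: "ip (J x) y = - ip x (J y)" if "x \<in> V" "y \<in> V" for x y
    using V(4)[OF V(2)[OF that(1)] that(2)] V(3)[OF that(1)] by (simp add: ip_simps)
  have Jx_orth: "ip x (J x) = 0" if "x \<in> V" for x
    using skew[OF that that] ip_sym[of x "J x"] by simp
  show ?case
  proof (cases "V \<subseteq> {0}")
    case True
    then have "V = {0}" using V(1) real_vector.subspace_0 by blast
    then show ?thesis
      by (intro exI[of _ "[]"]) (simp add: orthonormal_basis_def J_pairs_def)
  next
    case False
    then obtain v where v: "v \<in> V" "v \<notin> {0}" by blast
    obtain x where x: "x \<in> V" "ip x x = 1"
      using unit_normal_exists[OF fin, of "{0}" V v] v V(1) real_vector.subspace_0
      by (auto simp: real_vector.subspace_single_0)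
    note Jx = V(2)[OF x(1)]
    define V' where "V' = V \<inter> {y. ip x y = 0} \<inter> {y. ip (J x) y = 0}"
    have sub': "subspace V'"
      unfolding V'_def using V(1) subspace_orthogonal by (intro real_vector.subspace_inter)
    have JV': "J y \<in> V'" if "y \<in> V'" for y
      using that V(2,4) skew[OF x(1), of y] x(1) by (auto simp: V'_def)
    have "x \<notin> V'" using x(2) by (auto simp: V'_def)
    moreover have "V' \<subseteq> V" by (auto simp: V'_def)
    ultimately have "V' \<subset> V" using x(1) by blast
    then have "dim V' < dim V"
      using dim_less_if_subspace_psubset[OF fin sub' V(1)] by blast
    then obtain xs where xs: "orthonormal_basis ip V' (J_pairs J xs)"
      using less.hyps[of V'] sub' JV' V(3,4) by (auto simp: V'_def)
    have "ip (J x) (J x) = 1" using V(4)[OF x(1) x(1)] x(2) by simp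
    note J1 = orthonormal_basis_Cons[OF xs this]
    let ?W = "span (insert (J x) V')"
    have W: "orthonormal_basis ip ?W (J x # J_pairs J xs)"
      using J1 by (auto simp: V'_def)
    have "insert (J x) V' \<subseteq> {y. ip x y = 0}"
      using Jx_orth[OF x(1)] by (auto simp: V'_def)
    then have "?W \<subseteq> {y. ip x y = 0}"
      using subspace_orthogonal by (rule real_vector.span_minimal)
    then have U: "orthonormal_basis ip (span (insert x ?W)) (x # J x # J_pairs J xs)"
      using orthonormal_basis_Cons[OF W x(2)] by blast
    have "?W \<subseteq> V"
      using Jx V(1) by (intro real_vector.span_minimal) (auto simp: V'_def)
    then have "span (insert x ?W) \<subseteq> V"
      using x(1) V(1) by (intro real_vector.span_minimal) auto
    moreover have "V \<subseteq> span (insert x ?W)"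
    proof
      fix y assume y: "y \<in> V"
      \<comment> \<open>Removing the components along \<open>x\<close> and \<open>J x\<close> leaves
        a vector of \<open>V'\<close>.\<close>
      define z where "z = y - ip x y *\<^sub>R x - ip (J x) y *\<^sub>R J x"
      have "z \<in> V"
        unfolding z_def using y x(1) Jx V(1)
        by (intro real_vector.subspace_diff real_vector.subspace_scale)
      moreover have "ip (J x) x = 0" using Jx_orth[OF x(1)] ip_sym by metis
      ultimately have "z \<in> V'"
        using x Jx_orth[OF x(1)] \<open>ip (J x) (J x) = 1\<close>
        by (simp add: V'_def) (simp add: z_def ip_simps)
      then have "z + ip (J x) y *\<^sub>R J x \<in> ?W"
        by (intro real_vector.span_add real_vector.span_scale) (auto intro: real_vector.span_base)
      then have "(z + ip (J x) y *\<^sub>R J x) + ip x y *\<^sub>R x \<in> span (insert x ?W)"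
        by (intro real_vector.span_add[OF real_vector.span_base
              real_vector.span_scale[OF real_vector.span_base]]) auto
      then show "y \<in> span (insert x ?W)" by (simp only: z_def diff_add_cancel)
    qed
    ultimately show ?thesis
      using U by (intro exI[of _ "x # xs"]) (simp add: J_pairs_def)
  qed
qed

end


section \<open>Matrices in an orthonormal basis\<close>

lemma length_J_pairs [simp]: "length (J_pairs J xs) = 2 * length xs"
  by (induction xs) (auto simp: J_pairs_def)

lemma J_pairs_nth:
  assumes "k < length xs"
  shows "J_pairs J xs ! (2 * k) = xs ! k" "J_pairs J xs ! Suc (2 * k) = J (xs ! k)"
  using assms
proof (induction xs arbitrary: k)
  case (Cons x xs)
  { case 1 then show ?case using Cons.IH(1) by (cases k) (auto simp: J_pairs_def) }
  { case 2 then show ?case using Cons.IH(2) by (cases k) (auto simp: J_pairs_def) }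
qed auto

context inner_product_form
begin

definition matrix_on :: "'a list \<Rightarrow> ('a \<Rightarrow> 'a) \<Rightarrow> real mat" where
  "matrix_on bs f = mat (length bs) (length bs) (\<lambda>(i, j). ip (bs ! i) (f (bs ! j)))"

text \<open>Expand the image under \<open>g\<close> of a basis vector and apply \<open>f\<close>
  termwise. This converts commuting maps into commuting matrices.\<close>

lemma matrix_on_compose:
  assumes bs: "orthonormal_basis ip V bs"
    and f: "linear f" and g: "\<And>x. x \<in> V \<Longrightarrow> g x \<in> V"
  shows "matrix_on bs (\<lambda>x. f (g x)) = matrix_on bs f * matrix_on bs g"
proof (rule eq_matI)
  fix i j
  assume "i < dim_row (matrix_on bs f * matrix_on bs g)" "j < dim_col (matrix_on bs f * matrix_on bs g)"
  then have ij: "i < length bs" "j < length bs" by (simp_all add: matrix_on_def)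
  have "bs ! j \<in> V"
    using bs ij(2) by (metis nth_mem orthonormal_basis_def real_vector.span_base)
  then have "f (g (bs ! j)) = f (\<Sum>k<length bs. ip (bs ! k) (g (bs ! j)) *\<^sub>R (bs ! k))"
    using orthonormal_basis_expand[OF bs g] by metis
  also have "\<dots> = (\<Sum>k<length bs. ip (bs ! k) (g (bs ! j)) *\<^sub>R f (bs ! k))"
    using f by (simp add: linear_sum linear_scale)
  finally have "ip (bs ! i) (f (g (bs ! j))) =
      (\<Sum>k<length bs. ip (bs ! k) (g (bs ! j)) * ip (bs ! i) (f (bs ! k)))"
    by (simp add: ip_sum_right ip_scale_right)
  then show "matrix_on bs (\<lambda>x. f (g x)) $$ (i, j) = (matrix_on bs f * matrix_on bs g) $$ (i, j)"
    using ij by (simp add: matrix_on_def scalar_prod_def atLeast0LessThan mult.commute)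
qed (simp_all add: matrix_on_def)

lemma matrix_on_complex_structure:
  assumes bs: "orthonormal_basis ip V (J_pairs J xs)"
    and J: "\<And>x. x \<in> V \<Longrightarrow> J (J x) = - x"
  shows "matrix_on (J_pairs J xs) J = complex_structure_mat (length xs)"
proof (rule eq_matI)
  let ?bs = "J_pairs J xs"
  fix i j
  assume "i < dim_row (complex_structure_mat (length xs))"
    "j < dim_col (complex_structure_mat (length xs))"
  then have ij: "i < 2 * length xs" "j < 2 * length xs" by (simp_all add: complex_structure_mat_def)
  have on: "ip (?bs ! i) (?bs ! l) = (if i = l then 1 else 0)" if "l < 2 * length xs" for l
    using bs that ij by (simp add: orthonormal_basis_def)
  show "matrix_on ?bs J $$ (i, j) = complex_structure_mat (length xs) $$ (i, j)"
  proof (cases "even j")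
    case True
    then obtain k where k: "j = 2 * k" by blast
    then have "J (?bs ! j) = ?bs ! Suc j" using J_pairs_nth[of k xs J] ij by simp
    then show ?thesis using ij on[of "Suc j"] k
      by (auto simp: matrix_on_def complex_structure_mat_def)
  next
    case False
    then obtain k where k: "j = Suc (2 * k)" by (metis oddE Suc_eq_plus1)
    have "xs ! k \<in> V"
      using bs k ij J_pairs_nth(1)[of k xs J]
      by (metis (no_types, lifting) Suc_lessD length_J_pairs nat_mult_less_cancel1 nth_mem
          orthonormal_basis_def real_vector.span_base zero_less_numeral)
    then have "J (?bs ! j) = - (?bs ! (2 * k))" using J_pairs_nth[of k xs J] J k ij by simp
    then show ?thesis using ij on[of "2 * k"] k
      by (auto simp: matrix_on_def complex_structure_mat_def ip_simps)
  qed
qed (simp_all add: matrix_on_def complex_structure_mat_def)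

text \<open>Skewness is read off entrywise; commutation follows by computing the matrix of
  \<open>f\<close> after \<open>J\<close> and of \<open>J\<close> after \<open>f\<close> as
  products.\<close>

lemma matrix_on_unitary:
  assumes bs: "orthonormal_basis ip V (J_pairs J xs)"
    and J: "linear J" "\<And>x. x \<in> V \<Longrightarrow> J x \<in> V" "\<And>x. x \<in> V \<Longrightarrow> J (J x) = - x"
    and f: "linear f" "\<And>x. x \<in> V \<Longrightarrow> f x \<in> V"
    and skew: "\<And>x y. x \<in> V \<Longrightarrow> y \<in> V \<Longrightarrow> ip (f x) y = - ip x (f y)"
    and comm: "\<And>x. x \<in> V \<Longrightarrow> f (J x) = J (f x)"
  shows "matrix_on (J_pairs J xs) f \<in> unitary_mats (length xs)"
proof -
  let ?bs = "J_pairs J xs"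
  have mem: "?bs ! i \<in> V" if "i < 2 * length xs" for i
    using bs that by (metis length_J_pairs nth_mem orthonormal_basis_def real_vector.span_base)
  have "transpose_mat (matrix_on ?bs f) = - matrix_on ?bs f"
  proof (rule eq_matI)
    fix i j assume "i < dim_row (- matrix_on ?bs f)" "j < dim_col (- matrix_on ?bs f)"
    then have ij: "i < 2 * length xs" "j < 2 * length xs" by (simp_all add: matrix_on_def)
    then show "transpose_mat (matrix_on ?bs f) $$ (i, j) = (- matrix_on ?bs f) $$ (i, j)"
      using skew[OF mem[OF ij(1)] mem[OF ij(2)]] ip_sym by (simp add: matrix_on_def)
  qed (simp_all add: matrix_on_def)
  moreover have "matrix_on ?bs (\<lambda>x. f (J x)) = matrix_on ?bs (\<lambda>x. J (f x))"
    unfolding matrix_on_def by (rule cong_mat) (auto simp: comm mem)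
  then have "matrix_on ?bs f * complex_structure_mat (length xs) =
      complex_structure_mat (length xs) * matrix_on ?bs f"
    using matrix_on_compose[OF bs f(1) J(2)] matrix_on_compose[OF bs J(1) f(2)]
      matrix_on_complex_structure[OF bs J(3)] by simp
  ultimately show ?thesis
    by (simp add: unitary_mats_def matrix_on_def)
qed

lemma has_matrix_matrix_on:
  assumes "orthonormal_basis ip V bs" "\<And>x. x \<in> V \<Longrightarrow> f x \<in> V"
  shows "has_matrix bs f (matrix_on bs f)"
proof -
  have "bs ! j \<in> V" if "j < length bs" for j
    using assms(1) that by (metis nth_mem orthonormal_basis_def real_vector.span_base)
  then have "f (bs ! j) = (\<Sum>i<length bs. ip (bs ! i) (f (bs ! j)) *\<^sub>R (bs ! i))"
    if "j < length bs" for j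
    using orthonormal_basis_expand[OF assms(1) assms(2)] that by blast
  then show ?thesis by (simp add: has_matrix_def matrix_on_def)
qed

end

lemma has_matrix_cong:
  assumes "has_matrix bs f A" "\<And>v. v \<in> set bs \<Longrightarrow> g v = f v"
  shows "has_matrix bs g A"
  using assms by (simp add: has_matrix_def)

text \<open>Applied twice, for \<open>J h0\<close> and then \<open>u0\<close> with eigenvalue 0,
  this assembles the three diagonal blocks.\<close>

lemma has_matrix_Cons_eigenvector:
  assumes f: "has_matrix bs f A" and b: "f b = c *\<^sub>R b"
  shows "has_matrix (b # bs) f
    (four_block_mat (mat 1 1 (\<lambda>_. c)) (0\<^sub>m 1 (length bs)) (0\<^sub>m (length bs) 1) A)"
    (is "has_matrix _ _ ?A")
proof -
  have A: "A \<in> carrier_mat (length bs) (length bs)" using f by (simp add: has_matrix_def)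
  have "f ((b # bs) ! j) = (\<Sum>i<length (b # bs). ?A $$ (i, j) *\<^sub>R ((b # bs) ! i))"
    if "j < length (b # bs)" for j
  proof (cases j)
    case 0
    have "(\<Sum>i<length bs. ?A $$ (Suc i, 0) *\<^sub>R (bs ! i)) = 0"
      using A by (intro sum.neutral) auto
    then show ?thesis
      using A b 0 by (simp add: sum.lessThan_Suc_shift del: sum.lessThan_Suc)
  next
    case (Suc k)
    have "(\<Sum>i<length bs. ?A $$ (Suc i, Suc k) *\<^sub>R (bs ! i)) = (\<Sum>i<length bs. A $$ (i, k) *\<^sub>R (bs ! i))"
      using A that Suc by (intro sum.cong) auto
    then show ?thesis
      using A f that Suc
      by (simp add: sum.lessThan_Suc_shift has_matrix_def del: sum.lessThan_Suc)
  qed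
  moreover have "?A \<in> carrier_mat (length (b # bs)) (length (b # bs))"
    using four_block_carrier_mat[of "mat 1 1 (\<lambda>_. c)" 1 1 A] A by simp
  ultimately show ?thesis unfolding has_matrix_def by blast
qed


section \<open>CoKaehler Lie algebras\<close>

locale coKaehler_lie_algebra =
  fixes br :: "'a::real_vector \<Rightarrow> 'a \<Rightarrow> 'a" and \<xi> :: 'a and J :: "'a \<Rightarrow> 'a"
    and \<alpha> :: "'a \<Rightarrow> real" and ip :: "'a \<Rightarrow> 'a \<Rightarrow> real"
  assumes lie: "lie_algebra br" and coKaehler: "coKaehler br \<xi> J \<alpha> ip"
begin

sublocale inner_product_form ip
  using coKaehler by unfold_locales (simp add: coKaehler_def)

lemma linear_J: "linear J" and linear_alpha: "linear \<alpha>" and alpha_xi [simp]: "\<alpha> \<xi> = 1"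
  and J_J: "J (J x) = - x + \<alpha> x *\<^sub>R \<xi>"
  and ip_J_J: "ip (J x) (J y) = ip x y - \<alpha> x * \<alpha> y"
  using coKaehler by (auto simp: coKaehler_def)

lemma alpha_br [simp]: "\<alpha> (br x y) = 0"
  using coKaehler by (simp add: coKaehler_def ce_d1_def)

lemma nijenhuis_0: "br (J x) (J y) - J (br (J x) y) - J (br x (J y)) + J (J (br x y)) = 0"
  using coKaehler unfolding coKaehler_def nijenhuis_def by blast

lemma d_omega_0: "- ip (J (br x y)) z + ip (J (br x z)) y - ip (J (br y z)) x = 0"
  using coKaehler by (simp add: coKaehler_def ce_d2_def)

lemma linear_br_right: "linear (br x)" and linear_br_left: "linear (\<lambda>x. br x y)"
  and br_self [simp]: "br x x = 0"
  using lie by (auto simp: lie_algebra_def)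

lemmas alpha_simps = linear_add[OF linear_alpha] linear_scale[OF linear_alpha]
  linear_diff[OF linear_alpha] linear_neg[OF linear_alpha] linear_0[OF linear_alpha]

lemmas J_simps = linear_add[OF linear_J] linear_scale[OF linear_J]
  linear_diff[OF linear_J] linear_neg[OF linear_J] linear_0[OF linear_J]

lemmas br_simps = linear_add[OF linear_br_right] linear_scale[OF linear_br_right]
  linear_diff[OF linear_br_right] linear_neg[OF linear_br_right] linear_0[OF linear_br_right]
  linear_add[OF linear_br_left] linear_scale[OF linear_br_left]
  linear_diff[OF linear_br_left] linear_neg[OF linear_br_left] linear_0[OF linear_br_left]

lemma br_antisym: "br x y = - br y x"
  using br_self[of "x + y"] unfolding br_simps by (simp add: eq_neg_iff_add_eq_0 add.commute)

lemma J_xi [simp]: "J \<xi> = 0"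
proof -
  have JJ: "J (J \<xi>) = 0" using J_J[of \<xi>] by simp
  \<comment> \<open>The third power of \<open>J\<close> kills \<xi>, so the formula for the square,
    taken at \<open>J \<xi>\<close>, makes \<open>J \<xi>\<close> a multiple of \<xi>. Another
    application of \<open>J\<close> gives zero.\<close>
  then have *: "J \<xi> = \<alpha> (J \<xi>) *\<^sub>R \<xi>" using J_J[of "J \<xi>"] by (simp add: J_simps)
  then have "\<alpha> (J \<xi>) *\<^sub>R J \<xi> = 0" using JJ by (metis J_simps(2))
  then show ?thesis using * by auto
qed

lemma ip_xi_right [simp]: "ip x \<xi> = \<alpha> x"
  using ip_J_J[of x \<xi>] by simp

lemma ip_xi_left [simp]: "ip \<xi> x = \<alpha> x"
  using ip_xi_right ip_sym by metis

text \<open>Compare two evaluations of the third power of \<open>J\<close> at \<open>x\<close>: they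
  differ by \<open>\<alpha> (J x)\<close> times \<xi>.\<close>

lemma alpha_J [simp]: "\<alpha> (J x) = 0"
proof -
  have "J (J (J x)) = - J x" using J_J[of x] by (simp add: J_simps)
  then have "\<alpha> (J x) *\<^sub>R \<xi> = 0" using J_J[of "J x"] by simp
  then have "\<alpha> (\<alpha> (J x) *\<^sub>R \<xi>) = 0" by (simp only: alpha_simps)
  then show ?thesis by (simp only: alpha_simps alpha_xi real_scaleR_def mult_1_right)
qed

lemma J_J_ker: "\<alpha> x = 0 \<Longrightarrow> J (J x) = - x"
  using J_J by simp

lemma ip_J_skew: "ip (J x) y = - ip x (J y)"
  using ip_J_J[of x "J y"] by (simp add: J_J ip_simps)

lemma ip_J_self [simp]: "ip x (J x) = 0" "ip (J x) x = 0"
  using ip_J_skew[of x x] ip_sym[of x "J x"] by simp_all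

text \<open>As \<open>J \<xi> = 0\<close>, two terms of N_J(\<xi>, x) remain after simplification;
  all brackets lie in the kernel of \<alpha>, where \<open>J\<close> squares to minus the
  identity.\<close>

lemma br_xi_J: "br \<xi> (J x) = J (br \<xi> x)"
proof -
  have "- J (br \<xi> (J x)) = br \<xi> x"
    using nijenhuis_0[of \<xi> x] by (simp add: br_simps J_simps J_J_ker)
  then have "J (br \<xi> (J x)) = - br \<xi> x" by (metis minus_minus)
  then have "J (J (br \<xi> (J x))) = - J (br \<xi> x)" by (simp add: J_simps)
  then show ?thesis by (simp add: J_J_ker)
qed

lemma br_xi_skew:
  assumes "\<alpha> x = 0"
  shows "ip (br \<xi> x) y = - ip x (br \<xi> y)"
proof -
  \<comment> \<open>In d\<omega>(\<xi>, a, b) the term with \<open>br a b\<close> drops out, since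
    the image of \<open>J\<close> is orthogonal to \<xi>. Putting \<open>J x\<close> for
    \<open>a\<close> yields skewness.\<close>
  have *: "ip (J (br \<xi> a)) b = ip (J (br \<xi> b)) a" for a b
    using d_omega_0[of \<xi> a b] by simp
  have "ip (J (br \<xi> (J x))) y = ip (J (br \<xi> y)) (J x)" by (rule *)
  moreover have "J (br \<xi> (J x)) = - br \<xi> x" by (simp add: br_xi_J J_J_ker)
  moreover have "ip (J (br \<xi> y)) (J x) = ip (br \<xi> y) x" by (simp add: ip_J_J)
  ultimately show ?thesis using ip_sym by (simp add: ip_simps)
qed

lemma subspace_ker: "subspace {x. \<alpha> x = 0}"
  by (auto simp: subspace_def alpha_simps)

lemma finite_spanning_set: obtains B :: "'a set" where "finite B" "span B = UNIV"
  using lie by (auto simp: lie_algebra_def)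

end


section \<open>Almost abelian coKaehler Lie algebras\<close>

text \<open>Codimension one: adjoining any vector outside \<uu> already spans everything.\<close>

lemma almost_abelian_decompose:
  assumes "almost_abelian br e0 M \<uu>" "v \<notin> \<uu>"
  obtains s y where "y \<in> \<uu>" "x = s *\<^sub>R v + y"
proof -
  have sub: "subspace \<uu>" and dim: "dim (UNIV :: 'a set) = dim \<uu> + 1"
    using assms(1) by (auto simp: almost_abelian_def lie_ideal_def)
  obtain B :: "'a set" where B: "finite B" "span B = UNIV"
    using assms(1) by (auto simp: almost_abelian_def lie_algebra_def)
  let ?T = "span (insert v \<uu>)"
  have "\<uu> \<subset> ?T" using assms(2) real_vector.span_base[of _ "insert v \<uu>"] by blast
  then have "dim \<uu> < dim ?T"
    using dim_less_if_subspace_psubset[OF B sub real_vector.subspace_span] by blast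
  then have "?T = UNIV"
    using dim_less_if_subspace_psubset[OF B real_vector.subspace_span real_vector.subspace_UNIV, of "insert v \<uu>"]
      dim by (metis Suc_eq_plus1 not_less_eq psubsetI subset_UNIV)
  then obtain s where "x - s *\<^sub>R v \<in> \<uu>"
    using real_vector.span_breakdown_eq[of x v \<uu>] sub
    by (metis UNIV_I real_vector.span_eq_iff)
  then show thesis using that[of "x - s *\<^sub>R v" s] by simp
qed

text \<open>For an almost abelian \<open>\<hh>\<close> the equations \<open>N\<^sub>J = 0\<close> and \<open>d\<omega> = 0\<close> already force the
  block form of \<open>ad h0\<close> on \<open>\<hh> \<inter> \<uu>\<close>; what remains is \<open>[h0, u0] = 0\<close>. Writing
  \<open>u0 = a \<xi> + b h0\<close> with \<open>a \<noteq> 0\<close>, commutativity of \<open>\<uu>\<close> makes \<open>ad \<xi>\<close> a multiple of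
  \<open>ad h0\<close> on \<open>\<hh> \<inter> \<uu>\<close>, so \<open>[\<xi>, J h0]\<close> is a multiple of \<open>J h0\<close>. As \<open>ad \<xi>\<close> commutes
  with \<open>J\<close>, \<open>[\<xi>, h0]\<close> is a multiple of \<open>h0\<close>; it lies in \<open>\<uu>\<close> and \<open>h0\<close> does not.\<close>

locale coKaehler_transverse = coKaehler_lie_algebra +
  fixes e0 :: 'a and M :: "'a \<Rightarrow> 'a" and \<uu> :: "'a set" and h0 u0 :: 'a
  assumes aa: "almost_abelian br e0 M \<uu>"
    and h0: "\<alpha> h0 = 0" "ip h0 h0 = 1" "\<And>w. \<alpha> w = 0 \<Longrightarrow> w \<in> \<uu> \<Longrightarrow> ip h0 w = 0"
    and u0: "u0 \<in> \<uu>" "ip u0 u0 = 1" "\<And>w. \<alpha> w = 0 \<Longrightarrow> w \<in> \<uu> \<Longrightarrow> ip u0 w = 0"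
begin

section \<open>Relative position of \<uu>, the kernel of \<alpha>, and the two normals\<close>

lemma subspace_u: "subspace \<uu>" and br_in_u: "y \<in> \<uu> \<Longrightarrow> br x y \<in> \<uu>"
  and br_u_u: "x \<in> \<uu> \<Longrightarrow> y \<in> \<uu> \<Longrightarrow> br x y = 0"
  and M_eq: "x \<in> \<uu> \<Longrightarrow> M x = br e0 x"
  using aa by (auto simp: almost_abelian_def lie_ideal_def)

lemma h0_notin: "h0 \<notin> \<uu>"
  using h0 by fastforce

lemma alpha_u0: "\<alpha> u0 \<noteq> 0"
  using u0 by fastforce

lemma decompose_h0: obtains s y where "y \<in> \<uu>" "x = s *\<^sub>R h0 + y"
  using almost_abelian_decompose[OF aa h0_notin] .

text \<open>The coefficient of \<open>h0\<close> in the splitting of \<open>x\<close> along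
  \<open>h0\<close> and \<uu> equals \<open>ip h0 x\<close>. Membership in \<uu> thus becomes an
  orthogonality test, which \<open>J h0\<close> passes.\<close>

lemma ker_in_u_iff:
  assumes "\<alpha> x = 0"
  shows "x \<in> \<uu> \<longleftrightarrow> ip h0 x = 0"
proof -
  obtain s y where y: "y \<in> \<uu>" "x = s *\<^sub>R h0 + y" by (rule decompose_h0)
  then have "\<alpha> y = 0" using assms h0(1) by (simp add: alpha_simps)
  then have "ip h0 x = s" using y h0 by (simp add: ip_simps)
  then show ?thesis using y h0(3) assms by auto
qed

section \<open>The action of \<open>h0\<close> on the intersection of \<uu> with the kernel of
  \<alpha>\<close>

lemma br_h0_J:
  assumes "w \<in> \<uu>" "\<alpha> w = 0" "J w \<in> \<uu>"
  shows "br h0 (J w) = J (br h0 w)"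
proof -
  have "J h0 \<in> \<uu>" by (simp add: ker_in_u_iff)
  \<comment> \<open>In N_J(h0, w) the brackets of \<open>J h0\<close> with \<open>w\<close> and
    \<open>J w\<close> vanish, all three vectors being in the abelian \<uu>.\<close>
  then have "- J (br h0 (J w)) = br h0 w"
    using nijenhuis_0[of h0 w] assms br_u_u by (simp add: J_simps J_J_ker)
  then have "J (br h0 (J w)) = - br h0 w" by (metis minus_minus)
  then have "J (J (br h0 (J w))) = - J (br h0 w)" by (simp add: J_simps)
  then show ?thesis by (simp add: J_J_ker)
qed

text \<open>The future span of the pairs \<open>x, J x\<close>. It is cut out by orthogonality,
  which makes its \<open>J\<close>-invariance immediate; inclusion in \<uu> then comes from
  \<open>ker_in_u_iff\<close>.\<close>

definition W' :: "'a set" where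
  "W' = {x. \<alpha> x = 0 \<and> ip h0 x = 0 \<and> ip (J h0) x = 0}"

lemma W'_in_u: "x \<in> W' \<Longrightarrow> x \<in> \<uu>"
  by (simp add: W'_def ker_in_u_iff)

lemma W'_alpha: "x \<in> W' \<Longrightarrow> \<alpha> x = 0"
  by (simp add: W'_def)

lemma subspace_W': "subspace W'"
  by (auto simp: W'_def subspace_def alpha_simps ip_simps)

lemma J_W': "x \<in> W' \<Longrightarrow> J x \<in> W'"
  using ip_J_skew[of h0 x] by (simp add: W'_def ip_J_J)

lemma J_h0_in_u: "J h0 \<in> \<uu>"
  by (simp add: ker_in_u_iff)

lemma br_h0_J_W': "x \<in> W' \<Longrightarrow> br h0 (J x) = J (br h0 x)"
  using br_h0_J W'_in_u W'_alpha J_W' by blast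

text \<open>Both \<open>br h0 x\<close> and its image \<open>J (br h0 x) = br h0 (J x)\<close> lie
  in the ideal \<uu>, hence are orthogonal to \<open>h0\<close>; the second fact says that
  \<open>br h0 x\<close> is orthogonal to \<open>J h0\<close>.\<close>

lemma br_h0_W':
  assumes "x \<in> W'"
  shows "br h0 x \<in> W'"
proof -
  have "br h0 x \<in> \<uu>" "br h0 (J x) \<in> \<uu>"
    using assms W'_in_u J_W' br_in_u by blast+
  then have "ip h0 (br h0 x) = 0" "ip h0 (J (br h0 x)) = 0"
    using h0(3) br_h0_J_W'[OF assms] by auto
  then show ?thesis using ip_J_skew[of h0] by (simp add: W'_def)
qed

lemma br_h0_skew_W':
  assumes "x \<in> W'" "y \<in> W'"
  shows "ip (br h0 x) y = - ip x (br h0 y)"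
proof -
  have Jx: "J x \<in> W'" using assms J_W' by blast
  \<comment> \<open>This is d\<omega>(h0, J x, y) = 0, where \<open>br (J x) y\<close>
    vanishes.\<close>
  have "ip (J (br h0 (J x))) y = ip (J (br h0 y)) (J x)"
    using d_omega_0[of h0 "J x" y] br_u_u[of "J x" y] W'_in_u assms Jx
    by (simp add: J_simps)
  moreover have "J (br h0 (J x)) = - br h0 x"
    using br_h0_J_W' assms by (simp add: J_J_ker)
  ultimately show ?thesis
    using ip_sym by (simp add: ip_J_J ip_simps)
qed

lemma decompose_ker_u:
  assumes "x \<in> \<uu>" "\<alpha> x = 0"
  shows "x - ip (J h0) x *\<^sub>R J h0 \<in> W'"
  using assms h0 by (auto simp: W'_def alpha_simps ip_simps ip_J_J)

lemma br_h0_J_h0: obtains \<mu> where "br h0 (J h0) = \<mu> *\<^sub>R J h0"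
proof -
  let ?x = "br h0 (J h0)"
  define r where "r = ?x - ip (J h0) ?x *\<^sub>R J h0"
  have r: "r \<in> W'"
    unfolding r_def using br_in_u[OF J_h0_in_u] by (intro decompose_ker_u) auto
  \<comment> \<open>Closedness of \<omega> at \<open>h0\<close>, \<open>J h0\<close>,
    \<open>J r\<close> moves the bracket onto \<open>J r\<close>, and \<open>br h0 (J r)\<close>
    stays in \<open>W'\<close>, orthogonal to \<open>h0\<close>. So the \<open>W'\<close>-component
    \<open>r\<close> of \<open>?x\<close> is orthogonal to \<open>?x\<close>, hence zero.\<close>
  have "ip (J ?x) (J r) = ip (J (br h0 (J r))) (J h0)"
    using d_omega_0[of h0 "J h0" "J r"] br_u_u[OF J_h0_in_u, of "J r"] J_W'[OF r] W'_in_u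
    by (simp add: J_simps)
  also have "\<dots> = ip (br h0 (J r)) h0" using h0(1) by (simp add: ip_J_J)
  also have "\<dots> = 0" using br_h0_W'[OF J_W'[OF r]] ip_sym by (simp add: W'_def)
  finally have "ip ?x r = 0" by (simp add: ip_J_J)
  moreover have "ip (J h0) r = 0" using r by (simp add: W'_def)
  ultimately have "ip r r = 0" by (subst r_def) (simp add: ip_simps)
  then have "?x = ip (J h0) ?x *\<^sub>R J h0" by (simp add: r_def)
  then show thesis by (rule that)
qed

lemma u0_decompose: "u0 = \<alpha> u0 *\<^sub>R \<xi> + ip h0 u0 *\<^sub>R h0"
proof -
  define r where "r = u0 - \<alpha> u0 *\<^sub>R \<xi> - ip h0 u0 *\<^sub>R h0"
  have a: "\<alpha> r = 0" and i: "ip h0 r = 0"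
    using h0 by (simp_all add: r_def alpha_simps ip_simps)
  \<comment> \<open>Now \<open>r\<close> lies in the intersection to which \<open>u0\<close> is
    normal, so it is orthogonal to all three terms defining it.\<close>
  then have "r \<in> \<uu>" by (simp add: ker_in_u_iff)
  then have "ip r r = 0" using a i u0(3) by (subst r_def) (simp add: ip_simps)
  then show ?thesis by (simp add: r_def algebra_simps)
qed

lemma br_h0_u0: "br h0 u0 = 0"
proof -
  obtain \<mu> where \<mu>: "br h0 (J h0) = \<mu> *\<^sub>R J h0" by (rule br_h0_J_h0)
  define b where "b = ip h0 u0"
  have "br u0 (J h0) = \<alpha> u0 *\<^sub>R br \<xi> (J h0) + b *\<^sub>R br h0 (J h0)"
    by (subst u0_decompose) (simp add: br_simps b_def)
  then have "\<alpha> u0 *\<^sub>R J (br \<xi> h0) + (b * \<mu>) *\<^sub>R J h0 = 0"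
    using br_u_u[OF u0(1) J_h0_in_u] \<mu> by (simp add: br_xi_J)
  \<comment> \<open>Applying \<open>- J\<close> strips the \<open>J\<close> from the preceding
    relation, since \<open>br \<xi> h0\<close> and \<open>h0\<close> lie in the kernel of
    \<alpha>.\<close>
  moreover have "\<alpha> u0 *\<^sub>R br \<xi> h0 + (b * \<mu>) *\<^sub>R h0 =
      - J (\<alpha> u0 *\<^sub>R J (br \<xi> h0) + (b * \<mu>) *\<^sub>R J h0)"
    using h0(1) by (simp add: J_simps J_J_ker)
  ultimately have "\<alpha> u0 *\<^sub>R br \<xi> h0 + (b * \<mu>) *\<^sub>R h0 = 0"
    by (simp only: J_simps neg_equal_0_iff_equal)
  then have xi_h0: "\<alpha> u0 *\<^sub>R br \<xi> h0 = - ((b * \<mu>) *\<^sub>R h0)"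
    by (simp only: eq_neg_iff_add_eq_0)
  have "br h0 u0 = - br u0 h0" by (rule br_antisym)
  also have "br u0 h0 = \<alpha> u0 *\<^sub>R br \<xi> h0"
    by (subst u0_decompose) (simp add: br_simps)
  finally have eq: "br h0 u0 = (b * \<mu>) *\<^sub>R h0" using xi_h0 by simp
  have "ip h0 (br h0 u0) = 0" using h0(3) br_in_u[OF u0(1)] by simp
  then have "b * \<mu> = 0" unfolding eq using h0(2) by (simp add: ip_simps)
  then show ?thesis using eq by simp
qed

section \<open>Assembling the adapted basis and the block matrix\<close>

lemma adapted_matrix_exists:
  assumes dim: "dim (UNIV :: 'a set) = 2 * n + 1"
  shows "\<exists>xs m Mt. length xs = n - 1 \<and> adapted_basis J \<alpha> ip \<uu> h0 u0 xs \<and>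
       Mt \<in> unitary_mats (n - 1) \<and>
       has_matrix (u0 # J h0 # J_pairs J xs) M
         (diag_block_mat [0\<^sub>m 1 1, mat 1 1 (\<lambda>_. m), Mt])"
proof -
  obtain B :: "'a set" where B: "finite B" "span B = UNIV" by (rule finite_spanning_set)
  obtain xs where xs: "orthonormal_basis ip W' (J_pairs J xs)"
    using J_pairs_basis_exists[OF B linear_J subspace_W' J_W'] W'_alpha J_J_ker ip_J_J by auto
  let ?W = "{x. \<alpha> x = 0} \<inter> \<uu>"
  have sub_W: "subspace ?W" using subspace_ker subspace_u by (rule real_vector.subspace_inter)
  have J_h0: "J h0 \<in> ?W" using J_h0_in_u by simp
  have W: "span (insert (J h0) W') = ?W"
  proof
    show "span (insert (J h0) W') \<subseteq> ?W"
      using J_h0 W'_in_u W'_alpha sub_W by (intro real_vector.span_minimal) auto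
    show "?W \<subseteq> span (insert (J h0) W')"
    proof
      fix x assume "x \<in> ?W"
      then have "x - ip (J h0) x *\<^sub>R J h0 \<in> span W'"
        using decompose_ker_u by (intro real_vector.span_base) auto
      then show "x \<in> span (insert (J h0) W')" unfolding real_vector.span_breakdown_eq by blast
    qed
  qed
  have U: "span (insert u0 ?W) = \<uu>"
  proof
    show "span (insert u0 ?W) \<subseteq> \<uu>"
      using u0(1) subspace_u by (intro real_vector.span_minimal) auto
    show "\<uu> \<subseteq> span (insert u0 ?W)"
    proof
      fix x assume x: "x \<in> \<uu>"
      have "x - (\<alpha> x / \<alpha> u0) *\<^sub>R u0 \<in> ?W"
        using x u0(1) alpha_u0 subspace_u
        by (auto simp: alpha_simps intro: real_vector.subspace_diff real_vector.subspace_scale)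
      then have "x - (\<alpha> x / \<alpha> u0) *\<^sub>R u0 \<in> span ?W" by (rule real_vector.span_base)
      then show "x \<in> span (insert u0 ?W)" unfolding real_vector.span_breakdown_eq by blast
    qed
  qed
  have "ip (J h0) (J h0) = 1" using h0 by (simp add: ip_J_J)
  then have bW: "orthonormal_basis ip ?W (J h0 # J_pairs J xs)"
    using orthonormal_basis_Cons[OF xs, of "J h0"] W by (simp add: W'_def)
  then have bU: "orthonormal_basis ip \<uu> (u0 # J h0 # J_pairs J xs)"
    using orthonormal_basis_Cons[OF bW u0(2)] U u0(3) by simp
  have "dim \<uu> = 2 * n" using dim aa by (simp add: almost_abelian_def)
  \<comment> \<open>The basis of \<uu> has \<open>2 + 2 * length xs = 2 * n\<close> elements, so
    \<open>n\<close> is positive and the subtraction is not truncated.\<close>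
  then have len: "length xs = n - 1"
    using orthonormal_basis_length[OF bU] by simp
  have adapted: "adapted_basis J \<alpha> ip \<uu> h0 u0 xs"
    using h0 u0 h0_notin bW bU by (auto simp: adapted_basis_def Let_def)
  \<comment> \<open>The part \<open>y\<close> acts trivially on \<uu>, so only the multiple of
    \<open>h0\<close> contributes to \<open>M\<close>.\<close>
  obtain c y where y: "y \<in> \<uu>" "e0 = c *\<^sub>R h0 + y" by (rule decompose_h0)
  have M: "M x = c *\<^sub>R br h0 x" if "x \<in> \<uu>" for x
    using that y br_u_u by (simp add: M_eq br_simps)
  \<comment> \<open>A globally linear map agreeing with \<open>M\<close> on \<uu>, where alone
    \<open>M\<close> is constrained.\<close>
  define f where "f = (\<lambda>x. c *\<^sub>R br h0 x)"
  have lin: "linear f"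
    unfolding f_def using linear_br_right by (intro linear_compose_scale_right)
  have f_W': "f x \<in> W'" if "x \<in> W'" for x
    using br_h0_W'[OF that] subspace_W' by (simp add: f_def real_vector.subspace_scale)
  define Mt where "Mt = matrix_on (J_pairs J xs) f"
  have Mt: "Mt \<in> unitary_mats (n - 1)"
    unfolding Mt_def len[symmetric]
    using xs linear_J J_W' J_J_ker[OF W'_alpha] lin f_W'
    by (rule matrix_on_unitary) (auto simp: f_def ip_simps br_h0_skew_W' br_h0_J_W' J_simps)
  have Mt_carrier: "Mt \<in> carrier_mat (length (J_pairs J xs)) (length (J_pairs J xs))"
    by (simp add: Mt_def matrix_on_def)
  obtain \<mu> where \<mu>: "br h0 (J h0) = \<mu> *\<^sub>R J h0" by (rule br_h0_J_h0)
  \<comment> \<open>The entry \<open>m\<close> is \<open>c * \<mu>\<close>; the value at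
    \<open>u0\<close> is phrased as an eigenvalue equation to yield the zero block.\<close>
  have f_J_h0: "f (J h0) = (c * \<mu>) *\<^sub>R J h0" and f_u0: "f u0 = 0 *\<^sub>R u0"
    using \<mu> br_h0_u0 by (simp_all add: f_def)
  have "has_matrix (u0 # J h0 # J_pairs J xs) f
      (diag_block_mat [0\<^sub>m 1 1, mat 1 1 (\<lambda>_. c * \<mu>), Mt])"
  proof -
    have "0\<^sub>m 1 1 = mat 1 1 (\<lambda>_. 0 :: real)" by auto
    then show ?thesis
      using has_matrix_Cons_eigenvector[OF has_matrix_Cons_eigenvector[OF
            has_matrix_matrix_on[OF xs, of f, OF f_W'] f_J_h0] f_u0]
        Mt_carrier diag_block_mat_singleton[of Mt]
      by (simp add: Let_def flip: Mt_def del: diag_block_mat_singleton)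
  qed
  moreover have "M v = f v" if "v \<in> set (u0 # J h0 # J_pairs J xs)" for v
    using that bU M by (metis f_def orthonormal_basis_def real_vector.span_base)
  ultimately have "has_matrix (u0 # J h0 # J_pairs J xs) M
      (diag_block_mat [0\<^sub>m 1 1, mat 1 1 (\<lambda>_. c * \<mu>), Mt])"
    using has_matrix_cong by blast
  then show ?thesis using len adapted Mt by blast
qed

end

theorem theorem4p7:
  fixes br :: "'a::real_vector \<Rightarrow> 'a \<Rightarrow> 'a"
    and e0 \<xi> :: 'a and M J :: "'a \<Rightarrow> 'a" and \<uu> :: "'a set"
    and \<alpha> :: "'a \<Rightarrow> real" and ip :: "'a \<Rightarrow> 'a \<Rightarrow> real" and n :: nat
  assumes "almost_abelian br e0 M \<uu>"
    and "dim (UNIV :: 'a set) = 2 * n + 1"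
    and "coKaehler br \<xi> J \<alpha> ip"
  shows "(\<exists>ip' K. hermitian_structure_on \<uu> ip' K \<and> unitary_endomorphism_on \<uu> ip' K M) \<or>
    (\<exists>h0 u0 xs m Mt.
       length xs = n - 1 \<and> adapted_basis J \<alpha> ip \<uu> h0 u0 xs \<and>
       Mt \<in> unitary_mats (n - 1) \<and>
       has_matrix (u0 # J h0 # J_pairs J xs) M
         (diag_block_mat [0\<^sub>m 1 1, mat 1 1 (\<lambda>_. m), Mt]))"
proof -
  interpret coKaehler_lie_algebra br \<xi> J \<alpha> ip
    using assms by unfold_locales (auto simp: almost_abelian_def)
  have u: "subspace \<uu>" "\<And>x y. y \<in> \<uu> \<Longrightarrow> br x y \<in> \<uu>" "\<And>x y. x \<in> \<uu> \<Longrightarrow> y \<in> \<uu> \<Longrightarrow> br x y = 0"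
    "e0 \<notin> \<uu>" "\<And>x. x \<in> \<uu> \<Longrightarrow> M x = br e0 x"
    using assms(1) by (auto simp: almost_abelian_def lie_ideal_def)
  let ?h = "{x. \<alpha> x = 0}"
  show ?thesis
  proof (cases "?h = \<uu>")
    case True
    define a where "a = \<alpha> e0"
    have M: "M x = a *\<^sub>R br \<xi> x" if x: "x \<in> \<uu>" for x
    proof -
      \<comment> \<open>The coefficient \<open>a\<close> is chosen so that \<alpha> vanishes on the
        difference.\<close>
      have "e0 - a *\<^sub>R \<xi> \<in> \<uu>" using True by (auto simp: a_def alpha_simps)
      then have "br (e0 - a *\<^sub>R \<xi>) x = 0" using u(3) x by blast
      then show ?thesis using u(5)[OF x] by (simp add: br_simps)
    qed
    have "hermitian_structure_on \<uu> ip J"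
      unfolding True[symmetric] hermitian_structure_on_def inner_product_on_def endomorphism_on_def
      by (auto simp: ip_simps ip_pos J_simps J_J_ker ip_J_J intro: ip_sym)
    moreover have "unitary_endomorphism_on \<uu> ip J M"
      using True u(1) unfolding unitary_endomorphism_on_def endomorphism_on_def
      by (auto simp: M br_simps ip_simps alpha_simps J_simps br_xi_J br_xi_skew
          real_vector.subspace_add real_vector.subspace_scale algebra_simps)
    ultimately show ?thesis by blast
  next
    case False
    have e0: "\<exists>s y. y \<in> \<uu> \<and> x = s *\<^sub>R v + y" if "v \<notin> \<uu>" for v x
      using almost_abelian_decompose[OF assms(1) that] by metis
    \<comment> \<open>Otherwise \<uu> and a vector \<open>v\<close> of the kernel outside \<uu>
      would span everything, forcing \<alpha> to vanish at \<xi>.\<close>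
    have "\<exists>z\<in>\<uu>. \<alpha> z \<noteq> 0"
    proof (rule ccontr)
      assume *: "\<not> (\<exists>z\<in>\<uu>. \<alpha> z \<noteq> 0)"
      then obtain v where v: "\<alpha> v = 0" "v \<notin> \<uu>" using False by blast
      obtain s y where "y \<in> \<uu>" "\<xi> = s *\<^sub>R v + y" using e0[OF v(2)] by blast
      then have "\<alpha> \<xi> = 0" using * v(1) by (simp add: alpha_simps)
      then show False by simp
    qed
    then obtain z where z: "z \<in> \<uu>" "\<alpha> z \<noteq> 0" by blast
    have "\<not> ?h \<subseteq> \<uu>"
    proof
      assume *: "?h \<subseteq> \<uu>"
      \<comment> \<open>Correcting \<open>e0\<close> by a multiple of \<open>z\<close> moves it into
        the kernel of \<alpha>; if the kernel were inside \<uu>, then so would be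
        \<open>e0\<close>.\<close>
      have "\<alpha> (e0 - (\<alpha> e0 / \<alpha> z) *\<^sub>R z) = 0" using z(2) by (simp add: alpha_simps)
      then have "e0 - (\<alpha> e0 / \<alpha> z) *\<^sub>R z \<in> \<uu>" using * by blast
      then have "(e0 - (\<alpha> e0 / \<alpha> z) *\<^sub>R z) + (\<alpha> e0 / \<alpha> z) *\<^sub>R z \<in> \<uu>"
        using z(1) u(1) by (intro real_vector.subspace_add real_vector.subspace_scale)
      then show False using u(4) by simp
    qed
    then obtain v where v: "v \<in> ?h" "v \<notin> ?h \<inter> \<uu>" by blast
    obtain B :: "'a set" where B: "finite B" "span B = UNIV" by (rule finite_spanning_set)
    have W: "subspace (?h \<inter> \<uu>)"
      using subspace_ker u(1) by (rule real_vector.subspace_inter)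
    obtain h0 where h0: "h0 \<in> ?h" "ip h0 h0 = 1" "\<forall>w\<in>?h \<inter> \<uu>. ip h0 w = 0"
      using unit_normal_exists[OF B W subspace_ker _ v] by auto
    obtain u0 where u0: "u0 \<in> \<uu>" "ip u0 u0 = 1" "\<forall>w\<in>?h \<inter> \<uu>. ip u0 w = 0"
      using unit_normal_exists[OF B W u(1) _ z(1)] z(2) by auto
    interpret coKaehler_transverse br \<xi> J \<alpha> ip e0 M \<uu> h0 u0
      using h0 u0 assms(1) by unfold_locales auto
    show ?thesis using adapted_matrix_exists[OF assms(2)] by blast
  qed
qed

end
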